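(* Suppose the Radon harmonic measure system $\{\omega_\cdot^{D_\lambda}\}$ in $\mathbb{R}^n$ is translation and scaling closed and invariant (TSCI), and that for each $D\in\{D_\lambda\}$ the Radon–Nikodym derivative $\frac{\mathrm{d}\omega^D_x}{\mathrm{d}\omega^D_y}(z)$ is continuous with respect to $x,y\in D$ and $z\in\partial D$. If $D,D_1\in\{D_\lambda\}$, $A$ is a subset with $A\subset\subset D_1\subseteq D$ (i.e. $\overline A$ is compact and contained in $D_1$), and $\partial D$ is compact, then for any translation and scaling map $\nu$ with $\nu(D_1)\subseteq D$, $$H(\nu(A);D)\leq H(A;D_1)<+\infty.$$ Equivalently, with the constant $C:=H(A;D_1)$, for any $f\in L(\partial D;\omega_\cdot^D)$ with $f\ge0$ and any $x,y\in\nu(A)$, $$\omega_x^D(f)\leq C\,\omega_y^D(f).$$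
   Context: Measures: a measure on a set $Y$ is a map $\omega:2^Y\to[0,\infty]$ with $\omega(\emptyset)=0$ and countable subadditivity (an outer measure); measurability is in the sense of Carathéodory; it is Borel if every Borel set is measurable. It is Radon if it is Borel regular (Borel, and every set is contained in a Borel set of the same measure) and finite on compact sets. $\nu\ll\mu$ means $\mu(A)=0\Rightarrow\nu(A)=0$ for all $A\subseteq Y$. Write $\omega(f)=\int f\,\mathrm d\omega$, $\omega(A)=\omega(\chi_A)$. Below $X=\mathbb R^n$. Pre-harmonic measure: let $D\subset X$ be open with $\partial D\neq\emptyset$. A family of Borel measures $\{\omega^D_x:2^{\partial D}\to[0,1]:x\in D\}$ on $\partial D$ is a pre-harmonic measure relative to $D$ if for every connected component $V$ of $D$: (1) $\omega_x^D(\partial V)=1$ for all $x\in V$; (2) $\omega^D_x\ll\omega^D_y$ for all $x,y\in V$. Harmonic measure: let $\mathcal F_x=\{E\Delta N: E\subseteq\partial D\text{ Borel},\ N\subseteq\partial D,\ \omega_x^D(N)=0\}$ and $\mathcal F=\bigcap_{x\in D}\mathcal F_x$. Sets in $\mathcal F$ and functions measurable w.r.t. $\mathcal F$ are called $\omega_\cdot^D$-measurable. The pre-harmonic measure restricted to $\mathcal F$ is the harmonic measure $\omega_\cdot^D$ relative to $D$. $L(\partial D;\omega_\cdot^D)$ is the set of $\omega_\cdot^D$-measurable $f$ on $\partial D$ integrable with respect to $\omega_x^D$ for every $x\in D$. $\omega_\cdot^D$ is continuous if $x\mapsto\omega_x^D(f)$ is continuous on $D$ for every $f\in L(\partial D;\omega_\cdot^D)$.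 Convention: $\omega_y^D(f):=f(y)$ for $y\in\partial D$. Harmonic measure system: a family of continuous harmonic measures $\{\omega_\cdot^{D_\lambda}\}$ which is compatible: for any $D,\widetilde D\in\{D_\lambda\}$ with $D\cap\widetilde D\ne\emptyset$, any $f\in L(\partial D;\omega_\cdot^D)$ and $\widetilde f\in L(\partial\widetilde D;\omega_\cdot^{\widetilde D})$ such that $\omega_y^{\widetilde D}(\widetilde f)=f(y)$ for all $y\in\widetilde D\cap\partial D$ and $\omega_y^D(f)=\widetilde f(y)$ for all $y\in\partial\widetilde D\cap\overline D$, one has $\omega_x^D(f)=\omega_x^{\widetilde D}(\widetilde f)$ for all $x\in D\cap\widetilde D$. It is a Radon harmonic measure system if all the measures $\omega_x^{D_\lambda}$ are Radon. TSCI: a translation and scaling map is $\nu(x)=\nu_{\nu_0,x_0,k}(x):=\nu_0+k(x-x_0)$ with $x_0,\nu_0\in\mathbb R^n$, $k\in\mathbb R$, $k\ne0$. The system is TSCI if for all such $\nu$ and all $D\in\{D_\lambda\}$: (1) $\nu(D)\in\{D_\lambda\}$; (2) for every $\omega_\cdot^D$-measurable $A\subseteq\partial D$, $\nu(A)$ is $\omega_\cdot^{\nu(D)}$-measurable and $\omega_{\nu(x)}^{\nu(D)}(\nu(A))=\omega_x^D(A)$ for $x\in D$. Harnack index: for $A\subseteq D\in\{D_\lambda\}$, $$H(A;D):=\sup\left\{\frac{\omega_x^D(f)}{\omega_y^D(f)}:\ x,y\in A,\ f\in L(\partial D;\omega_\cdot^D)\setminus\{0\},\ f\ge0\right\}\in[1,+\infty],$$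 where functions agreeing off an $\omega_\cdot^D$-null set (null for all $\omega_x^D$, $x\in D$) are identified.
   Formalization: Finiteness of H(A;D_1) is claimed only when the boundary of D_1 is compact (automatic for bounded D), since it can fail for unbounded D with D_1 of noncompact boundary; H(ν(A);D) ≤ H(A;D_1), finiteness of H(ν(A);D) and the Harnack inequality are proved without this condition. *)

theory Defs
  imports "HOL-Analysis.Analysis"
begin

section \<open>Measures in the sense of Caratheodory\<close>

text \<open>
  A measure on a set \<open>Y\<close> is an outer measure, i.e. a function on all subsets of \<open>Y\<close>;
  its values outside \<open>Pow Y\<close> are irrelevant.  \<^const>\<open>lambda_system\<close> is the library's
  collection of Caratheodory measurable sets.
\<close>

definition borel_measure_on :: "'a::topological_space set \<Rightarrow> ('a set \<Rightarrow> ennreal) \<Rightarrow> bool" where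
  "borel_measure_on Y \<mu> \<longleftrightarrow>
     outer_measure_space (Pow Y) \<mu> \<and>
     sets (restrict_space borel Y) \<subseteq> lambda_system Y (Pow Y) \<mu>"

definition radon_measure_on :: "'a::topological_space set \<Rightarrow> ('a set \<Rightarrow> ennreal) \<Rightarrow> bool" where
  "radon_measure_on Y \<mu> \<longleftrightarrow>
     borel_measure_on Y \<mu> \<and>
     (\<forall>A\<subseteq>Y. \<exists>B\<in>sets (restrict_space borel Y). A \<subseteq> B \<and> \<mu> B = \<mu> A) \<and>
     (\<forall>K\<subseteq>Y. compact K \<longrightarrow> \<mu> K < \<infinity>)"

text \<open>
  Here \<open>abs_cont_on Y \<nu> \<mu>\<close> means that \<open>\<nu>\<close> is absolutely continuous with respect to
  \<open>\<mu>\<close>.  All subsets of \<open>Y\<close> are tested, not only the measurable ones.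
\<close>

definition abs_cont_on :: "'a set \<Rightarrow> ('a set \<Rightarrow> ennreal) \<Rightarrow> ('a set \<Rightarrow> ennreal) \<Rightarrow> bool" where
  "abs_cont_on Y \<nu> \<mu> \<longleftrightarrow> (\<forall>A\<subseteq>Y. \<mu> A = 0 \<longrightarrow> \<nu> A = 0)"


section \<open>Harmonic measures\<close>

text \<open>In this section \<open>w x\<close> is the measure with pole \<open>x \<in> D\<close> on \<open>frontier D\<close>.\<close>

definition pre_harmonic ::
    "'a::euclidean_space set \<Rightarrow> ('a \<Rightarrow> 'a set \<Rightarrow> ennreal) \<Rightarrow> bool" where
  "pre_harmonic D w \<longleftrightarrow>
     open D \<and> frontier D \<noteq> {} \<and>
     (\<forall>x\<in>D. borel_measure_on (frontier D) (w x) \<and> (\<forall>A\<subseteq>frontier D. w x A \<le> 1)) \<and>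
     (\<forall>V\<in>components D.
        (\<forall>x\<in>V. w x (frontier V) = 1) \<and>
        (\<forall>x\<in>V. \<forall>y\<in>V. abs_cont_on (frontier D) (w x) (w y)))"

definition harm_sets_at ::
    "'a::euclidean_space set \<Rightarrow> ('a \<Rightarrow> 'a set \<Rightarrow> ennreal) \<Rightarrow> 'a \<Rightarrow> 'a set set" where
  "harm_sets_at D w x =
     {sym_diff E N | E N. E \<in> sets (restrict_space borel (frontier D)) \<and>
        N \<subseteq> frontier D \<and> w x N = 0}"

definition harm_sets ::
    "'a::euclidean_space set \<Rightarrow> ('a \<Rightarrow> 'a set \<Rightarrow> ennreal) \<Rightarrow> 'a set set" where
  "harm_sets D w = (\<Inter>x\<in>D. harm_sets_at D w x)"

text \<open>
  The restriction of \<open>w x\<close> to \<^const>\<open>harm_sets\<close>, as a measure space.  That \<^const>\<open>measure_of\<close>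
  does not degenerate here is the content of \<open>sets_harm_measure\<close> and
  \<open>emeasure_harm_measure\<close> below.
\<close>

definition harm_measure ::
    "'a::euclidean_space set \<Rightarrow> ('a \<Rightarrow> 'a set \<Rightarrow> ennreal) \<Rightarrow> 'a \<Rightarrow> 'a measure" where
  "harm_measure D w x = measure_of (frontier D) (harm_sets D w) (w x)"

definition harm_L ::
    "'a::euclidean_space set \<Rightarrow> ('a \<Rightarrow> 'a set \<Rightarrow> ennreal) \<Rightarrow> ('a \<Rightarrow> real) set" where
  "harm_L D w = {f. \<forall>x\<in>D. integrable (harm_measure D w x) f}"

text \<open>
  For \<open>x \<in> D\<close> this is the integral of \<open>f\<close>; on the boundary it is \<open>f\<close> itself, by convention.
  The set \<open>D\<close> is open in all uses, so the two cases do not overlap.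
\<close>

definition harm_val ::
    "'a::euclidean_space set \<Rightarrow> ('a \<Rightarrow> 'a set \<Rightarrow> ennreal) \<Rightarrow> 'a \<Rightarrow> ('a \<Rightarrow> real) \<Rightarrow> real" where
  "harm_val D w x f = (if x \<in> frontier D then f x else integral\<^sup>L (harm_measure D w x) f)"

definition continuous_harmonic ::
    "'a::euclidean_space set \<Rightarrow> ('a \<Rightarrow> 'a set \<Rightarrow> ennreal) \<Rightarrow> bool" where
  "continuous_harmonic D w \<longleftrightarrow>
     pre_harmonic D w \<and> (\<forall>f\<in>harm_L D w. continuous_on D (\<lambda>x. harm_val D w x f))"


section \<open>Systems of harmonic measures\<close>

text \<open>
  A system is given by its collection \<open>\<D>\<close> of domains together with, for every
  \<open>D \<in> \<D>\<close>, the family \<open>\<omega> D\<close> of measures on \<open>frontier D\<close>.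
\<close>

definition compatible_pair ::
    "('a::euclidean_space set \<Rightarrow> 'a \<Rightarrow> 'a set \<Rightarrow> ennreal) \<Rightarrow> 'a set \<Rightarrow> 'a set \<Rightarrow> bool" where
  "compatible_pair \<omega> D D' \<longleftrightarrow>
     (\<forall>f\<in>harm_L D (\<omega> D). \<forall>f'\<in>harm_L D' (\<omega> D').
        (\<forall>y\<in>D' \<inter> frontier D. harm_val D' (\<omega> D') y f' = f y) \<longrightarrow>
        (\<forall>y\<in>frontier D' \<inter> closure D. harm_val D (\<omega> D) y f = f' y) \<longrightarrow>
        (\<forall>x\<in>D \<inter> D'. harm_val D (\<omega> D) x f = harm_val D' (\<omega> D') x f'))"

definition harmonic_measure_system ::
    "'a::euclidean_space set set \<Rightarrow> ('a set \<Rightarrow> 'a \<Rightarrow> 'a set \<Rightarrow> ennreal) \<Rightarrow> bool" where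
  "harmonic_measure_system \<D> \<omega> \<longleftrightarrow>
     (\<forall>D\<in>\<D>. continuous_harmonic D (\<omega> D)) \<and>
     (\<forall>D\<in>\<D>. \<forall>D'\<in>\<D>. D \<inter> D' \<noteq> {} \<longrightarrow> compatible_pair \<omega> D D')"

definition radon_harmonic_measure_system ::
    "'a::euclidean_space set set \<Rightarrow> ('a set \<Rightarrow> 'a \<Rightarrow> 'a set \<Rightarrow> ennreal) \<Rightarrow> bool" where
  "radon_harmonic_measure_system \<D> \<omega> \<longleftrightarrow>
     harmonic_measure_system \<D> \<omega> \<and>
     (\<forall>D\<in>\<D>. \<forall>x\<in>D. radon_measure_on (frontier D) (\<omega> D x))"

definition ts_map :: "'a::euclidean_space \<Rightarrow> 'a \<Rightarrow> real \<Rightarrow> 'a \<Rightarrow> 'a" where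
  "ts_map \<nu>\<^sub>0 x\<^sub>0 k = (\<lambda>x. \<nu>\<^sub>0 + k *\<^sub>R (x - x\<^sub>0))"

definition is_ts_map :: "('a::euclidean_space \<Rightarrow> 'a) \<Rightarrow> bool" where
  "is_ts_map \<nu> \<longleftrightarrow> (\<exists>\<nu>\<^sub>0 x\<^sub>0 k. k \<noteq> 0 \<and> \<nu> = ts_map \<nu>\<^sub>0 x\<^sub>0 k)"

definition TSCI ::
    "'a::euclidean_space set set \<Rightarrow> ('a set \<Rightarrow> 'a \<Rightarrow> 'a set \<Rightarrow> ennreal) \<Rightarrow> bool" where
  "TSCI \<D> \<omega> \<longleftrightarrow>
     (\<forall>\<nu> D. is_ts_map \<nu> \<longrightarrow> D \<in> \<D> \<longrightarrow>
        \<nu> ` D \<in> \<D> \<and>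
        (\<forall>A\<in>harm_sets D (\<omega> D).
           \<nu> ` A \<in> harm_sets (\<nu> ` D) (\<omega> (\<nu> ` D)) \<and>
           (\<forall>x\<in>D. \<omega> (\<nu> ` D) (\<nu> x) (\<nu> ` A) = \<omega> D x A)))"


section \<open>Radon-Nikodym derivatives and the Harnack index\<close>

definition is_RN_derivative :: "'a measure \<Rightarrow> 'a measure \<Rightarrow> ('a \<Rightarrow> real) \<Rightarrow> bool" where
  "is_RN_derivative M N g \<longleftrightarrow>
     g \<in> borel_measurable N \<and> (\<forall>z\<in>space N. 0 \<le> g z) \<and> density N (\<lambda>z. ennreal (g z)) = M"

text \<open>
  A Radon-Nikodym derivative is determined only up to null sets, so its continuity means
  that there is a version which is jointly continuous in both poles and the
  boundary point.  The poles range over all of \<open>D\<close>, also over different components.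
\<close>

definition continuous_RN ::
    "'a::euclidean_space set \<Rightarrow> ('a \<Rightarrow> 'a set \<Rightarrow> ennreal) \<Rightarrow> bool" where
  "continuous_RN D w \<longleftrightarrow>
     (\<exists>K :: 'a \<Rightarrow> 'a \<Rightarrow> 'a \<Rightarrow> real.
        (\<forall>x\<in>D. \<forall>y\<in>D. is_RN_derivative (harm_measure D w x) (harm_measure D w y) (K x y)) \<and>
        continuous_on (D \<times> D \<times> frontier D) (\<lambda>(x, y, z). K x y z))"

definition harm_null ::
    "'a::euclidean_space set \<Rightarrow> ('a \<Rightarrow> 'a set \<Rightarrow> ennreal) \<Rightarrow> 'a set \<Rightarrow> bool" where
  "harm_null D w N \<longleftrightarrow> N \<subseteq> frontier D \<and> (\<forall>x\<in>D. w x N = 0)"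

text \<open>
  The condition \<open>\<not> harm_null \<dots>\<close> says that \<open>f\<close> is not the zero class when functions
  agreeing off a null set are identified.  In \<^typ>\<open>ennreal\<close>, \<open>a / 0 = \<infinity>\<close> for \<open>a > 0\<close> and
  \<open>0 / 0 = 0\<close>.  For \<open>A = {}\<close> the value is \<open>0\<close>, otherwise it is at least \<open>1\<close>.
\<close>

definition harnack_index ::
    "'a::euclidean_space set \<Rightarrow> 'a set \<Rightarrow> ('a \<Rightarrow> 'a set \<Rightarrow> ennreal) \<Rightarrow> ennreal" where
  "harnack_index A D w =
     Sup {ennreal (harm_val D w x f) / ennreal (harm_val D w y f) | x y f.
            x \<in> A \<and> y \<in> A \<and> f \<in> harm_L D w \<and>
            (\<forall>z\<in>frontier D. 0 \<le> f z) \<and> \<not> harm_null D w {z\<in>frontier D. f z \<noteq> 0}}"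


section \<open>The measure spaces are well defined\<close>

lemma borel_frontier_sets:
  "E \<in> sets (restrict_space borel (frontier D)) \<longleftrightarrow> E \<in> sets borel \<and> E \<subseteq> frontier D"
  for D :: "'a::euclidean_space set"
  by (auto simp: sets_restrict_space_iff)

lemma harm_sets_at_sigma_algebra:
  assumes om: "outer_measure_space (Pow (frontier D)) (w x)"
  shows "sigma_algebra (frontier D) (harm_sets_at D w x)"
  unfolding sigma_algebra_iff2
proof (intro conjI ballI allI impI)
  have pos: "w x {} = 0"
    using om by (simp add: outer_measure_space_def positive_def)
  show "harm_sets_at D w x \<subseteq> Pow (frontier D)"
    by (auto simp: harm_sets_at_def borel_frontier_sets)
  show "{} \<in> harm_sets_at D w x"
    using pos unfolding harm_sets_at_def by (force simp: borel_frontier_sets)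
next
  fix s assume "s \<in> harm_sets_at D w x"
  then obtain E N where s: "s = sym_diff E N" and E: "E \<in> sets borel" "E \<subseteq> frontier D"
    and N: "N \<subseteq> frontier D" "w x N = 0"
    by (auto simp: harm_sets_at_def borel_frontier_sets)
  have "frontier D - s = sym_diff (frontier D - E) N"
    using s E N by auto
  moreover have "frontier D - E \<in> sets borel"
    using E by (simp add: borel_closed sets.Diff)
  ultimately show "frontier D - s \<in> harm_sets_at D w x"
    using N unfolding harm_sets_at_def borel_frontier_sets by blast
next
  fix A :: "nat \<Rightarrow> 'a set" assume A: "range A \<subseteq> harm_sets_at D w x"
  have "\<forall>i. \<exists>E N. A i = sym_diff E N \<and> E \<in> sets borel \<and> E \<subseteq> frontier D \<and>
      N \<subseteq> frontier D \<and> w x N = 0"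
  proof
    fix i
    have "A i \<in> harm_sets_at D w x" using A by (rule range_subsetD)
    then show "\<exists>E N. A i = sym_diff E N \<and> E \<in> sets borel \<and> E \<subseteq> frontier D \<and>
        N \<subseteq> frontier D \<and> w x N = 0"
      unfolding harm_sets_at_def borel_frontier_sets mem_Collect_eq by (elim exE conjE) (intro exI conjI)
  qed
  from choice[OF this] obtain E where "\<forall>i. \<exists>N. A i = sym_diff (E i) N \<and> E i \<in> sets borel \<and>
      E i \<subseteq> frontier D \<and> N \<subseteq> frontier D \<and> w x N = 0" ..
  from choice[OF this] obtain N where "\<forall>i. A i = sym_diff (E i) (N i) \<and> E i \<in> sets borel \<and>
      E i \<subseteq> frontier D \<and> N i \<subseteq> frontier D \<and> w x (N i) = 0" ..
  then have EN: "\<And>i. A i = sym_diff (E i) (N i)" "\<And>i. E i \<in> sets borel"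
      "\<And>i. E i \<subseteq> frontier D" "\<And>i. N i \<subseteq> frontier D" "\<And>i. w x (N i) = 0"
    by iprover+
  define M where "M = sym_diff (\<Union>i. A i) (\<Union>i. E i)"
  have M: "M \<subseteq> (\<Union>i. N i)" unfolding M_def
  proof
    fix z assume "z \<in> sym_diff (\<Union>i. A i) (\<Union>i. E i)"
    then obtain i where "z \<in> A i \<and> z \<notin> E i \<or> z \<in> E i \<and> z \<notin> A i" by blast
    then show "z \<in> (\<Union>i. N i)" using EN(1)[of i] by blast
  qed
  have inc: "increasing (Pow (frontier D)) (w x)"
    and csa: "countably_subadditive (Pow (frontier D)) (w x)"
    using om by (simp_all add: outer_measure_space_def)
  have mono: "w x S \<le> w x T" if "S \<subseteq> T" "T \<subseteq> frontier D" for S T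
    by (rule increasingD[OF inc that(1)]) (use that in blast)+
  have dis: "disjointed N i \<subseteq> frontier D" for i
    using EN(4)[of i] disjointed_subset[of N i] by (rule order_trans[rotated])
  have zero: "w x (disjointed N i) = 0" for i
    using mono[OF disjointed_subset[of N i] EN(4)[of i]] EN(5)[of i] by simp
  have "range (disjointed N) \<subseteq> Pow (frontier D)" "(\<Union>i. disjointed N i) \<in> Pow (frontier D)"
    using dis by blast+
  then have "w x (\<Union>i. disjointed N i) \<le> (\<Sum>i. w x (disjointed N i))"
    using csa disjoint_family_disjointed[of N] unfolding countably_subadditive_def by simp
  then have "w x (\<Union>i. N i) = 0"
    by (simp add: zero UN_disjointed_eq)
  moreover have N: "(\<Union>i. N i) \<subseteq> frontier D" using EN(4) by (rule UN_least)
  ultimately have "w x M = 0" using mono[OF M] by simp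
  moreover have "(\<Union>i. A i) = sym_diff (\<Union>i. E i) M" unfolding M_def by blast
  moreover have "(\<Union>i. E i) \<in> sets borel"
    using EN(2) by (intro sets.countable_UN) blast
  moreover have "(\<Union>i. E i) \<subseteq> frontier D" using EN(3) by (rule UN_least)
  moreover have "M \<subseteq> frontier D" using M N by (rule order_trans)
  ultimately show "(\<Union>i. A i) \<in> harm_sets_at D w x"
    unfolding harm_sets_at_def borel_frontier_sets mem_Collect_eq by (intro exI conjI)
qed

lemma null_in_lambda_system:
  assumes om: "outer_measure_space (Pow Y) \<mu>" and N: "N \<subseteq> Y" "\<mu> N = 0"
  shows "N \<in> lambda_system Y (Pow Y) \<mu>"
proof -
  interpret sigma_algebra Y "Pow Y" by (rule sigma_algebra_Pow)
  have inc: "increasing (Pow Y) \<mu>" and pos: "positive (Pow Y) \<mu>"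
    and csa: "countably_subadditive (Pow Y) \<mu>"
    using om by (simp_all add: outer_measure_space_def)
  have sub: "subadditive (Pow Y) \<mu>"
    by (rule countably_subadditive_subadditive[OF pos csa])
  show ?thesis
    unfolding lambda_system_eq
  proof (intro CollectI conjI ballI)
    fix A assume A: "A \<in> Pow Y"
    have "\<mu> (A \<inter> N) \<le> \<mu> N" using A N by (intro increasingD[OF inc]) auto
    then have z: "\<mu> (A \<inter> N) = 0" using N by simp
    have "\<mu> (A - N) \<le> \<mu> A" using A by (intro increasingD[OF inc]) auto
    moreover have "\<mu> ((A \<inter> N) \<union> (A - N)) \<le> \<mu> (A \<inter> N) + \<mu> (A - N)"
      using A by (intro subadditiveD[OF sub]) auto
    moreover have "(A \<inter> N) \<union> (A - N) = A" by auto
    ultimately show "\<mu> (A \<inter> N) + \<mu> (A - N) = \<mu> A" using z by auto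
  qed (use N in auto)
qed

lemma harm_measure_space:
  assumes ph: "pre_harmonic D w" and x: "x \<in> D"
  shows "measure_space (frontier D) (harm_sets D w) (w x)"
proof -
  have om: "outer_measure_space (Pow (frontier D)) (w y)"
    and bo: "sets (restrict_space borel (frontier D)) \<subseteq>
      lambda_system (frontier D) (Pow (frontier D)) (w y)" if "y \<in> D" for y
    using ph that by (auto simp: pre_harmonic_def borel_measure_on_def)
  let ?L = "lambda_system (frontier D) (Pow (frontier D)) (w x)"
  have ms: "measure_space (frontier D) ?L (w x)"
    by (rule sigma_algebra.caratheodory_lemma[OF sigma_algebra_Pow om[OF x]])
  then interpret L: sigma_algebra "frontier D" ?L by (simp add: measure_space_def)
  have sub: "harm_sets D w \<subseteq> ?L"
  proof
    fix S assume "S \<in> harm_sets D w"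
    then have "S \<in> harm_sets_at D w x" using x by (simp add: harm_sets_def)
    then obtain E N where S: "S = sym_diff E N" and E: "E \<in> sets (restrict_space borel (frontier D))"
      and N: "N \<subseteq> frontier D" "w x N = 0"
      unfolding harm_sets_at_def by blast
    have "E \<in> ?L" using E bo[OF x] by (rule subsetD[rotated])
    moreover have "N \<in> ?L" using om[OF x] N by (rule null_in_lambda_system)
    ultimately show "S \<in> ?L" unfolding S by (intro L.Un L.Diff)
  qed
  have sa: "sigma_algebra (frontier D) (harm_sets_at D w y)" if "y \<in> D" for y
    using om[OF that] by (rule harm_sets_at_sigma_algebra)
  have "sigma_algebra (frontier D) (harm_sets D w)"
    unfolding sigma_algebra_iff2
  proof (intro conjI ballI allI impI)
    show "harm_sets D w \<subseteq> Pow (frontier D)" using sub L.space_closed by (rule order_trans)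
  next
    show "{} \<in> harm_sets D w"
      unfolding harm_sets_def
      by (rule INT_I, rule sigma_algebra.sigma_sets_subset[OF sa, THEN subsetD])
        (auto intro: sigma_sets.Empty)
  next
    fix s assume s: "s \<in> harm_sets D w"
    show "frontier D - s \<in> harm_sets D w"
      unfolding harm_sets_def
    proof (rule INT_I)
      fix y assume y: "y \<in> D"
      with s have "s \<in> harm_sets_at D w y" by (simp add: harm_sets_def)
      with sa[OF y] show "frontier D - s \<in> harm_sets_at D w y"
        by (simp add: sigma_algebra_iff2)
    qed
  next
    fix A :: "nat \<Rightarrow> 'a set" assume A: "range A \<subseteq> harm_sets D w"
    show "(\<Union>i. A i) \<in> harm_sets D w"
      unfolding harm_sets_def
    proof (rule INT_I)
      fix y assume y: "y \<in> D"
      then have "harm_sets D w \<subseteq> harm_sets_at D w y" unfolding harm_sets_def by (rule INT_lower)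
      with A have "range A \<subseteq> harm_sets_at D w y" by (rule order_trans)
      with sa[OF y] show "(\<Union>i. A i) \<in> harm_sets_at D w y"
        by (simp add: sigma_algebra_iff2)
    qed
  qed
  then show ?thesis using measure_down[OF ms _ sub] by simp
qed

lemma sets_harm_measure:
  assumes "pre_harmonic D w" "x \<in> D"
  shows "space (harm_measure D w x) = frontier D" "sets (harm_measure D w x) = harm_sets D w"
proof -
  interpret sigma_algebra "frontier D" "harm_sets D w"
    using harm_measure_space[OF assms] by (simp add: measure_space_def)
  show "space (harm_measure D w x) = frontier D" "sets (harm_measure D w x) = harm_sets D w"
    by (simp_all add: harm_measure_def space_measure_of[OF space_closed])
qed

lemma emeasure_harm_measure:
  assumes "pre_harmonic D w" "x \<in> D" "A \<in> harm_sets D w"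
  shows "emeasure (harm_measure D w x) A = w x A"
proof -
  have "sigma_algebra (frontier D) (harm_sets D w)"
    "positive (harm_sets D w) (w x)" "countably_additive (harm_sets D w) (w x)"
    using harm_measure_space[OF assms(1,2)] by (simp_all add: measure_space_def)
  then show ?thesis
    unfolding harm_measure_def using assms(3) by (intro emeasure_measure_of_sigma) auto
qed

end

theory Submission
  imports Defs
begin

text \<open>
  The kernel \<open>d\<omega>\<^sub>x/d\<omega>\<^sub>y\<close> is bounded on the compact set
  \<open>closure A \<times> closure A \<times> frontier D\<close>, which makes the Harnack index finite.  For the comparison,
  put \<open>D' = \<nu> ` D\<^sub>1 \<subseteq> D\<close>.  A nonnegative \<open>f \<in> L(\<partial>D)\<close> induces the boundary function
  \<open>f' y = \<omega>\<^sub>y\<^sup>D(f)\<close> on \<open>\<partial>D'\<close>; once \<open>f' \<in> L(\<partial>D')\<close> is known, compatibility gives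
  \<open>\<omega>\<^sub>x\<^sup>D(f) = \<omega>\<^sub>x\<^sup>D\<^sup>'(f')\<close> on \<open>D'\<close>, so every ratio occurring in \<open>H(\<nu>(A); D)\<close> also occurs in
  \<open>H(\<nu>(A); D') = H(A; D\<^sub>1)\<close>.  Measurability of \<open>f'\<close> on \<open>\<partial>D \<inter> \<partial>D'\<close> needs that \<open>\<omega>\<^sup>D\<close>-null sets are
  \<open>\<omega>\<^sup>D\<^sup>'\<close>-null there, which is compatibility applied to the indicator of a Borel null set;
  integrability follows by truncating \<open>f\<close>.
\<close>

section \<open>Harmonic measures of a single domain\<close>

lemma continuous_harmonicD:
  assumes "radon_harmonic_measure_system \<D> \<omega>" "D \<in> \<D>"
  shows "continuous_harmonic D (\<omega> D)" "pre_harmonic D (\<omega> D)"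
  using assms
  by (auto simp: radon_harmonic_measure_system_def harmonic_measure_system_def continuous_harmonic_def)

lemma outer_measure_space_le_zero:
  assumes "outer_measure_space (Pow Y) \<mu>" "S \<subseteq> T" "T \<subseteq> Y" "\<mu> T = 0"
  shows "\<mu> S = 0"
proof -
  have "increasing (Pow Y) \<mu>" using assms(1) by (simp add: outer_measure_space_def)
  then have "\<mu> S \<le> \<mu> T"
    using assms(2) by (rule increasingD) (use assms(2,3) in blast)+
  then show ?thesis using assms(4) by simp
qed

context
  fixes D :: "'a::euclidean_space set" and w :: "'a \<Rightarrow> 'a set \<Rightarrow> ennreal"
  assumes ph: "pre_harmonic D w"
begin

text \<open>For \<open>D = {}\<close> the intersection defining \<open>harm_sets\<close> would run
  over no poles and equal \<open>UNIV\<close>. A pole is what ties \<open>harm_sets\<close> to an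
  actual measure space in the next two lemmas.\<close>

lemma pre_harmonic_nonempty: "D \<noteq> {}"
  using ph by (auto simp: pre_harmonic_def)

lemma pre_harmonic_frontier_disjoint: "D \<inter> frontier D = {}"
  using ph by (auto simp: pre_harmonic_def frontier_def interior_open)

lemma harm_sets_subset: "S \<in> harm_sets D w \<Longrightarrow> S \<subseteq> frontier D"
  using pre_harmonic_nonempty sets.sets_into_space sets_harm_measure[OF ph]
  by (metis ex_in_conv)

lemma frontier_in_harm_sets: "frontier D \<in> harm_sets D w"
  using pre_harmonic_nonempty sets.top sets_harm_measure[OF ph] by (metis ex_in_conv)

lemma finite_measure_harm_measure:
  assumes x: "x \<in> D"
  shows "finite_measure (harm_measure D w x)" "measure (harm_measure D w x) (frontier D) \<le> 1"
proof -
  have "emeasure (harm_measure D w x) (frontier D) = w x (frontier D)"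
    by (rule emeasure_harm_measure[OF ph x frontier_in_harm_sets])
  then have le: "emeasure (harm_measure D w x) (frontier D) \<le> 1"
    using ph x by (simp add: pre_harmonic_def)
  then show "finite_measure (harm_measure D w x)"
    using sets_harm_measure(1)[OF ph x] by (intro finite_measureI) (auto simp: top_unique)
  show "measure (harm_measure D w x) (frontier D) \<le> 1"
    using le unfolding measure_def by (simp add: enn2real_leI)
qed

lemma harm_val_interior:
  assumes "x \<in> D" shows "harm_val D w x f = integral\<^sup>L (harm_measure D w x) f"
  using assms pre_harmonic_frontier_disjoint by (auto simp: harm_val_def)

lemma harm_val_nonneg:
  assumes x: "x \<in> D" and f: "\<forall>z\<in>frontier D. 0 \<le> f z"
  shows "0 \<le> harm_val D w x f"
  unfolding harm_val_interior[OF x]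
  by (rule integral_nonneg_AE) (use f sets_harm_measure(1)[OF ph x] in auto)

text \<open>Membership in \<open>harm_sets\<close> allows a different decomposition at each pole;
  here one pair \<open>E\<close>, \<open>N\<close> serves all poles at once.\<close>

lemma harm_sets_borelI:
  assumes E: "E \<in> sets borel" "E \<subseteq> frontier D" and N: "N \<subseteq> frontier D" "\<And>x. x \<in> D \<Longrightarrow> w x N = 0"
  shows "sym_diff E N \<in> harm_sets D w"
  unfolding harm_sets_def harm_sets_at_def borel_frontier_sets using assms by blast

lemma borel_in_harm_sets:
  assumes "E \<in> sets borel" "E \<subseteq> frontier D"
  shows "E \<in> harm_sets D w"
proof -
  have "w x {} = 0" if "x \<in> D" for x
    using ph that
    by (auto simp: pre_harmonic_def borel_measure_on_def outer_measure_space_def positive_def)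
  then show ?thesis using harm_sets_borelI[OF assms, of "{}"] by simp
qed

lemma harm_L_bounded:
  assumes m: "\<And>x. x \<in> D \<Longrightarrow> f \<in> borel_measurable (harm_measure D w x)"
    and b: "\<And>z. z \<in> frontier D \<Longrightarrow> \<bar>f z\<bar> \<le> B"
  shows "f \<in> harm_L D w"
  unfolding harm_L_def
proof (intro CollectI ballI)
  fix x assume x: "x \<in> D"
  interpret finite_measure "harm_measure D w x" by (rule finite_measure_harm_measure[OF x])
  show "integrable (harm_measure D w x) f"
    by (rule integrable_const_bound[where B = B])
      (use m[OF x] b sets_harm_measure(1)[OF ph x] in auto)
qed

lemma indicator_in_harm_L: "S \<in> harm_sets D w \<Longrightarrow> indicator S \<in> harm_L D w"
  by (rule harm_L_bounded[where B = 1])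
    (auto simp: sets_harm_measure(2)[OF ph] split: split_indicator intro!: borel_measurable_indicator)

lemma harm_val_indicator:
  assumes "S \<in> harm_sets D w" "x \<in> D"
  shows "harm_val D w x (indicator S) = enn2real (w x S)"
  using assms harm_sets_subset[OF assms(1)] sets_harm_measure(1)[OF ph assms(2)]
  by (simp add: harm_val_interior measure_def emeasure_harm_measure[OF ph] Int_absorb2)

lemma harm_val_null:
  assumes x: "x \<in> D" and "harm_null D w {z \<in> frontier D. f z \<noteq> 0}"
    and f: "f \<in> harm_L D w"
  shows "harm_val D w x f = 0"
proof -
  let ?N = "{z \<in> frontier D. f z \<noteq> 0}"
  have sp: "space (harm_measure D w x) = frontier D" by (rule sets_harm_measure(1)[OF ph x])
  have "f \<in> borel_measurable (harm_measure D w x)" using f x by (auto simp: harm_L_def)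
  then have "{z \<in> space (harm_measure D w x). f z \<noteq> 0} \<in> sets (harm_measure D w x)" by measurable
  then have N: "?N \<in> harm_sets D w" using sets_harm_measure[OF ph x] by simp
  have "?N \<in> null_sets (harm_measure D w x)"
    using N assms sets_harm_measure[OF ph x] emeasure_harm_measure[OF ph x N]
    by (auto simp: harm_null_def)
  then have "AE z in harm_measure D w x. f z = 0"
    by (rule AE_I') (use sp in auto)
  then show ?thesis unfolding harm_val_interior[OF x] by (rule integral_eq_zero_AE)
qed

end

section \<open>Consequences of a continuous Radon-Nikodym kernel\<close>

lemma continuous_RN_bound:
  assumes ph: "pre_harmonic D w" and rn: "continuous_RN D w"
    and A: "compact (closure A)" "closure A \<subseteq> D" and fr: "compact (frontier D)"
  obtains C where "0 \<le> C"
    "\<And>x y f. \<lbrakk>x \<in> A; y \<in> A; f \<in> harm_L D w; \<forall>z\<in>frontier D. 0 \<le> f z\<rbrakk>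
      \<Longrightarrow> harm_val D w x f \<le> C * harm_val D w y f"
proof -
  obtain K where K: "\<And>x y. x \<in> D \<Longrightarrow> y \<in> D \<Longrightarrow>
        is_RN_derivative (harm_measure D w x) (harm_measure D w y) (K x y)"
    and Kc: "continuous_on (D \<times> D \<times> frontier D) (\<lambda>(x, y, z). K x y z)"
    using rn unfolding continuous_RN_def by blast
  let ?P = "closure A \<times> closure A \<times> frontier D"
  have "compact ((\<lambda>(x, y, z). K x y z) ` ?P)"
    using A fr by (intro compact_continuous_image continuous_on_subset[OF Kc] compact_Times) auto
  then obtain C0 where C0: "\<forall>v\<in>(\<lambda>(x, y, z). K x y z) ` ?P. norm v \<le> C0"
    using compact_imp_bounded bounded_iff by metis
  \<comment> \<open>If \<open>A\<close> is empty, the image is empty and \<open>C0\<close> may be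
    negative; the maximum ensures that \<open>C\<close> is nonnegative, so that
    \<open>ennreal C\<close> is faithful.\<close>
  define C where "C = max C0 0"
  have Kb: "K x y z \<le> C" if "x \<in> A" "y \<in> A" "z \<in> frontier D" for x y z
  proof -
    have "(x, y, z) \<in> ?P" using that closure_subset by blast
    then have "norm (K x y z) \<le> C0" using C0 by force
    then show ?thesis by (simp add: C_def)
  qed
  show ?thesis
  proof
    show "0 \<le> C" by (simp add: C_def)
  next
    fix x y f assume xA: "x \<in> A" and yA: "y \<in> A" and f: "f \<in> harm_L D w"
      and f0: "\<forall>z\<in>frontier D. 0 \<le> f z"
    have x: "x \<in> D" and y: "y \<in> D" using xA yA A(2) closure_subset by blast+
    let ?M = "harm_measure D w y"
    have sp: "space ?M = frontier D" by (rule sets_harm_measure(1)[OF ph y])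
    have Km: "K x y \<in> borel_measurable ?M" and K0: "AE z in ?M. 0 \<le> K x y z"
      and Kd: "harm_measure D w x = density ?M (\<lambda>z. ennreal (K x y z))"
      using K[OF x y] by (auto simp: is_RN_derivative_def)
    have fx: "integrable (harm_measure D w x) f" and fy: "integrable ?M f"
      using f x y by (auto simp: harm_L_def)
    then have fm: "f \<in> borel_measurable ?M" by simp
    have "integral\<^sup>L (harm_measure D w x) f = (\<integral>z. K x y z * f z \<partial>?M)"
      unfolding Kd using integral_density[OF fm Km K0] by simp
    also have "\<dots> \<le> (\<integral>z. C * f z \<partial>?M)"
    proof (rule integral_mono)
      show "integrable ?M (\<lambda>z. K x y z * f z)"
        using fx integrable_density[OF fm Km K0] unfolding Kd by simp
      show "integrable ?M (\<lambda>z. C * f z)" using fy by simp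
      show "K x y z * f z \<le> C * f z" if "z \<in> space ?M" for z
        using that f0 Kb[OF xA yA] unfolding sp by (intro mult_right_mono) auto
    qed
    finally show "harm_val D w x f \<le> C * harm_val D w y f"
      by (simp add: harm_val_interior[OF ph] x y)
  qed
qed

lemma harnack_index_finite:
  assumes ph: "pre_harmonic D w" and rn: "continuous_RN D w"
    and A: "compact (closure A)" "closure A \<subseteq> D" and fr: "compact (frontier D)"
  shows "harnack_index A D w < \<infinity>"
proof -
  obtain C where C: "0 \<le> C"
    "\<And>x y f. \<lbrakk>x \<in> A; y \<in> A; f \<in> harm_L D w; \<forall>z\<in>frontier D. 0 \<le> f z\<rbrakk>
      \<Longrightarrow> harm_val D w x f \<le> C * harm_val D w y f"
    using continuous_RN_bound[OF assms] by blast
  have "harnack_index A D w \<le> ennreal C"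
    unfolding harnack_index_def
  proof (rule Sup_least, clarify)
    fix x y f assume xA: "x \<in> A" and yA: "y \<in> A" and f: "f \<in> harm_L D w"
      and f0: "\<forall>z\<in>frontier D. 0 \<le> f z"
    have y: "y \<in> D" using yA A(2) closure_subset by blast
    have nn: "0 \<le> harm_val D w y f" by (rule harm_val_nonneg[OF ph y f0])
    have le: "harm_val D w x f \<le> C * harm_val D w y f" by (rule C(2)[OF xA yA f f0])
    show "ennreal (harm_val D w x f) / ennreal (harm_val D w y f) \<le> ennreal C"
    \<comment> \<open>A vanishing denominator makes the numerator at most 0 by the kernel bound, so
      the quotient is \<open>0 / 0 = 0\<close> and not \<open>\<infinity>\<close>.\<close>
    proof (cases "harm_val D w y f = 0")
      case True
      then show ?thesis using le by (simp add: ennreal_neg)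
    next
      case False
      then have "0 < harm_val D w y f" using nn by simp
      then show ?thesis
        using le C(1) by (cases "0 \<le> harm_val D w x f")
          (auto simp: divide_ennreal ennreal_neg field_simps intro!: ennreal_leI)
    qed
  qed
  then show ?thesis by (simp add: le_less_trans)
qed

text \<open>Densities exist for every pair of poles, so null sets are shared by all of
  \<open>D\<close>. The absolute continuity in \<open>pre_harmonic\<close> covers only poles in the
  same component.\<close>

lemma continuous_RN_null:
  assumes ph: "pre_harmonic D w" and rn: "continuous_RN D w"
    and x: "x \<in> D" and y: "y \<in> D" and S: "S \<in> harm_sets D w" "w x S = 0"
  shows "w y S = 0"
proof -
  obtain g where "is_RN_derivative (harm_measure D w y) (harm_measure D w x) g"
    using rn x y unfolding continuous_RN_def by blast
  then have "absolutely_continuous (harm_measure D w x) (harm_measure D w y)"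
    unfolding is_RN_derivative_def
    by (metis absolutely_continuousI_density measurable_compose measurable_ennreal)
  moreover have "S \<in> null_sets (harm_measure D w x)"
    using S sets_harm_measure(2)[OF ph x] emeasure_harm_measure[OF ph x] by auto
  ultimately have "emeasure (harm_measure D w y) S = 0"
    unfolding absolutely_continuous_def by blast
  then show ?thesis using emeasure_harm_measure[OF ph y S(1)] by simp
qed

section \<open>Comparison of a domain with a subdomain\<close>

locale nested_domains =
  fixes \<D> :: "'a::euclidean_space set set" and \<omega> :: "'a set \<Rightarrow> 'a \<Rightarrow> 'a set \<Rightarrow> ennreal"
    and D D' :: "'a set"
  assumes sys: "radon_harmonic_measure_system \<D> \<omega>"
    and rn: "continuous_RN D (\<omega> D)"
    and D: "D \<in> \<D>" and D': "D' \<in> \<D>" and sub: "D' \<subseteq> D"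
begin

lemmas ph = continuous_harmonicD(2)[OF sys D] and ph' = continuous_harmonicD(2)[OF sys D']

lemma frontier_cases: "z \<in> frontier D' \<Longrightarrow> z \<in> D \<or> z \<in> frontier D"
  using closure_mono[OF sub] closure_Un_frontier[of D] closure_Un_frontier[of D'] by blast

text \<open>For nested domains \<open>D'\<close> does not meet \<open>frontier D\<close>, so the
  first boundary condition of \<open>compatible_pair\<close> is vacuous. The second one says that
  \<open>f'\<close> is the trace on \<open>frontier D'\<close> of the harmonic extension of
  \<open>f\<close>.\<close>

lemma compatible:
  assumes "f \<in> harm_L D (\<omega> D)" "f' \<in> harm_L D' (\<omega> D')"
    and "\<And>z. z \<in> frontier D' \<Longrightarrow> harm_val D (\<omega> D) z f = f' z" and "x \<in> D'"
  shows "harm_val D (\<omega> D) x f = harm_val D' (\<omega> D') x f'"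
proof -
  have "D \<inter> D' \<noteq> {}" using assms(4) sub by auto
  then have "compatible_pair \<omega> D D'"
    using sys D D' by (auto simp: radon_harmonic_measure_system_def harmonic_measure_system_def)
  moreover have "D' \<inter> frontier D = {}" using sub pre_harmonic_frontier_disjoint[OF ph] by blast
  ultimately show ?thesis using assms sub unfolding compatible_pair_def by blast
qed

text \<open>Borel regularity encloses \<open>N\<close> in a Borel null set \<open>B\<close>. The
  extension of \<open>indicator B\<close> vanishes inside \<open>D\<close>, so its trace on
  \<open>frontier D'\<close> is the indicator of \<open>B \<inter> frontier D'\<close>;
  compatibility then says that this set has measure 0 from \<open>y\<close>.\<close>

lemma null_Int_frontier:
  assumes N: "N \<subseteq> frontier D" "\<omega> D x N = 0" and x: "x \<in> D" and y: "y \<in> D'"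
  shows "\<omega> D' y (N \<inter> frontier D') = 0"
proof -
  have "radon_measure_on (frontier D) (\<omega> D x)"
    using sys D x by (auto simp: radon_harmonic_measure_system_def)
  then have "\<exists>B\<in>sets (restrict_space borel (frontier D)). N \<subseteq> B \<and> \<omega> D x B = \<omega> D x N"
    using N(1) unfolding radon_measure_on_def by blast
  then obtain B where "B \<in> sets (restrict_space borel (frontier D))" "N \<subseteq> B" "\<omega> D x B = \<omega> D x N"
    by (elim bexE conjE)
  then have B: "B \<in> sets borel" "B \<subseteq> frontier D" "N \<subseteq> B" "\<omega> D x B = 0"
    using N(2) by (simp_all add: borel_frontier_sets)
  have Bh: "B \<in> harm_sets D (\<omega> D)" using B by (intro borel_in_harm_sets[OF ph])
  have B0: "\<omega> D z B = 0" if "z \<in> D" for z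
    by (rule continuous_RN_null[OF ph rn x that Bh B(4)])
  let ?B = "B \<inter> frontier D'"
  have Bh': "?B \<in> harm_sets D' (\<omega> D')"
    using B by (intro borel_in_harm_sets[OF ph']) (auto intro: borel_closed)
  have yD: "y \<in> D" using y sub by auto
  have "harm_val D (\<omega> D) y (indicator B) = harm_val D' (\<omega> D') y (indicator ?B)"
  proof (rule compatible[OF indicator_in_harm_L[OF ph Bh] indicator_in_harm_L[OF ph' Bh'] _ y])
    fix z assume z: "z \<in> frontier D'"
    show "harm_val D (\<omega> D) z (indicator B) = indicator ?B z"
    proof (cases "z \<in> frontier D")
      case True
      then show ?thesis using z by (simp add: harm_val_def indicator_def)
    next
      case False
      then have "z \<in> D" "z \<notin> B" using frontier_cases[OF z] B by auto
      then show ?thesis by (simp add: harm_val_indicator[OF ph Bh] B0)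
    qed
  qed
  then have "enn2real (\<omega> D' y ?B) = 0"
    by (simp add: harm_val_indicator[OF ph Bh yD] harm_val_indicator[OF ph' Bh' y] B0[OF yD])
  \<comment> \<open>Since \<open>enn2real\<close> also sends \<open>\<infinity>\<close> to 0,
    infinite measure has to be excluded.\<close>
  moreover have "\<omega> D' y ?B \<le> 1" using ph' y by (auto simp: pre_harmonic_def)
  ultimately have z: "\<omega> D' y ?B = 0"
    by (auto simp: enn2real_eq_0_iff top_unique)
  have "outer_measure_space (Pow (frontier D')) (\<omega> D' y)"
    using ph' y by (auto simp: pre_harmonic_def borel_measure_on_def)
  then show ?thesis
    by (rule outer_measure_space_le_zero[where T = ?B]) (use z B in auto)
qed

text \<open>The preimage of an open set splits in two. Inside \<open>D\<close> it is open, because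
  the extension is continuous there; on \<open>frontier D\<close> it is a preimage under
  \<open>f\<close>, which is Borel up to a null set.\<close>

lemma harm_val_measurable:
  assumes f: "f \<in> harm_L D (\<omega> D)" and y: "y \<in> D'"
  shows "(\<lambda>z. harm_val D (\<omega> D) z f) \<in> borel_measurable (harm_measure D' (\<omega> D') y)"
proof (rule borel_measurableI)
  fix U :: "real set" assume U: "open U"
  let ?h = "\<lambda>z. harm_val D (\<omega> D) z f"
  have yD: "y \<in> D" using y sub by auto
  have sp': "space (harm_measure D' (\<omega> D') y) = frontier D'"
    and st': "sets (harm_measure D' (\<omega> D') y) = harm_sets D' (\<omega> D')"
    by (rule sets_harm_measure[OF ph' y])+
  have "f -` U \<inter> space (harm_measure D (\<omega> D) y) \<in> sets (harm_measure D (\<omega> D) y)"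
    using f U yD by (intro measurable_sets[of _ _ borel]) (auto simp: harm_L_def)
  then have "f -` U \<inter> frontier D \<in> harm_sets D (\<omega> D)"
    using sets_harm_measure[OF ph yD] by simp
  \<comment> \<open>The decomposition at the single pole \<open>y\<close> suffices: by
    \<open>null_Int_frontier\<close> the trace of its null part is null from every pole of
    \<open>D'\<close>.\<close>
  then have "f -` U \<inter> frontier D \<in> harm_sets_at D (\<omega> D) y" using yD by (auto simp: harm_sets_def)
  then obtain E N where EN: "f -` U \<inter> frontier D = sym_diff E N"
    and E: "E \<in> sets borel" "E \<subseteq> frontier D" and N: "N \<subseteq> frontier D" "\<omega> D y N = 0"
    unfolding harm_sets_at_def borel_frontier_sets by blast
  have "sym_diff (E \<inter> frontier D') (N \<inter> frontier D') \<in> harm_sets D' (\<omega> D')"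
    using E null_Int_frontier[OF N yD]
    by (intro harm_sets_borelI[OF ph']) (auto intro: borel_closed)
  moreover have "sym_diff (E \<inter> frontier D') (N \<inter> frontier D') = (f -` U \<inter> frontier D) \<inter> frontier D'"
    unfolding EN by auto
  ultimately have 1: "(f -` U \<inter> frontier D) \<inter> frontier D' \<in> harm_sets D' (\<omega> D')" by simp
  have "open D" using ph by (simp add: pre_harmonic_def)
  moreover have "continuous_on D ?h"
    using continuous_harmonicD(1)[OF sys D] f by (simp add: continuous_harmonic_def)
  ultimately have "open (?h -` U \<inter> D)" using U by (metis continuous_on_open_vimage)
  then have 2: "?h -` U \<inter> D \<inter> frontier D' \<in> harm_sets D' (\<omega> D')"
    by (intro borel_in_harm_sets[OF ph'] sets.Int[OF borel_open borel_closed]) auto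
  have "?h z = f z" if "z \<in> frontier D" for z
    using that by (simp add: harm_val_def)
  then have "?h -` U \<inter> frontier D' = ((f -` U \<inter> frontier D) \<inter> frontier D') \<union> (?h -` U \<inter> D \<inter> frontier D')"
    by (fastforce dest: frontier_cases)
  also have "\<dots> \<in> sets (harm_measure D' (\<omega> D') y)"
    by (rule sets.Un) (use 1 2 st' in simp_all)
  finally show "?h -` U \<inter> space (harm_measure D' (\<omega> D') y) \<in> sets (harm_measure D' (\<omega> D') y)"
    unfolding sp' .
qed

text \<open>Compatibility cannot be applied to \<open>f\<close> directly, since it presupposes that
  the trace is integrable. It does apply to the truncations, whose traces are bounded, and monotone
  convergence passes to the limit.\<close>

lemma harm_val_in_harm_L:
  assumes f: "f \<in> harm_L D (\<omega> D)" and f0: "\<forall>z\<in>frontier D. 0 \<le> f z"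
  shows "(\<lambda>z. harm_val D (\<omega> D) z f) \<in> harm_L D' (\<omega> D')"
proof -
  define t where "t n z = min (f z) (real n)" for n z
  have int: "integrable (harm_measure D (\<omega> D) x) f" if "x \<in> D" for x
    using f that by (auto simp: harm_L_def)
  have t_L: "t n \<in> harm_L D (\<omega> D)" for n
  proof (rule harm_L_bounded[OF ph, where B = "real n"])
    show "t n \<in> borel_measurable (harm_measure D (\<omega> D) x)" if "x \<in> D" for x
      using int[OF that] unfolding t_def by measurable
  qed (use f0 in \<open>auto simp: t_def\<close>)
  have t_int: "integrable (harm_measure D (\<omega> D) x) (t n)" if "x \<in> D" for x n
    using t_L that by (auto simp: harm_L_def)
  have t_le: "t m z \<le> t n z" if "m \<le> n" for m n z
    using that by (auto simp: t_def)
  have t_lim: "(\<lambda>n. t n z) \<longlonglongrightarrow> f z" for z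
  proof (rule tendsto_eventually)
    obtain m where "f z \<le> real m" using real_arch_simple by blast
    then show "\<forall>\<^sub>F n in sequentially. t n z = f z"
      by (intro eventually_sequentiallyI[of m]) (auto simp: t_def)
  qed
  let ?h = "\<lambda>z. harm_val D (\<omega> D) z f"
  let ?t = "\<lambda>n z. harm_val D (\<omega> D) z (t n)"
  have h_lim: "(\<lambda>n. ?t n z) \<longlonglongrightarrow> ?h z" if "z \<in> D \<or> z \<in> frontier D" for z
  proof (cases "z \<in> frontier D")
    case True
    then show ?thesis using t_lim by (simp add: harm_val_def)
  next
    case False
    then have z: "z \<in> D" using that by simp
    show ?thesis
      unfolding harm_val_interior[OF ph z]
    proof (rule integral_dominated_convergence[where w = f])
      show "AE x in harm_measure D (\<omega> D) z. norm (t n x) \<le> f x" for n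
        using f0 sets_harm_measure(1)[OF ph z] by (auto simp: t_def)
    qed (use int[OF z] t_int[OF z] t_lim in auto)
  qed
  have h_mono: "?t m z \<le> ?t n z" if "m \<le> n" "z \<in> D \<or> z \<in> frontier D" for m n z
  proof (cases "z \<in> frontier D")
    case True
    then show ?thesis using t_le[OF that(1)] by (simp add: harm_val_def)
  next
    case False
    then have z: "z \<in> D" using that by simp
    show ?thesis
      unfolding harm_val_interior[OF ph z] by (rule integral_mono[OF t_int[OF z] t_int[OF z] t_le[OF that(1)]])
  qed
  \<comment> \<open>Each \<open>\<omega> D z\<close> has total mass at most 1, so extending to the
    interior preserves the bound \<open>n\<close>.\<close>
  have h_bound: "\<bar>?t n z\<bar> \<le> real n" if "z \<in> D \<or> z \<in> frontier D" for n z
  proof (cases "z \<in> frontier D")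
    case True
    then show ?thesis using f0 by (auto simp: harm_val_def t_def)
  next
    case False
    then have z: "z \<in> D" using that by simp
    interpret finite_measure "harm_measure D (\<omega> D) z" by (rule finite_measure_harm_measure[OF ph z])
    have "integral\<^sup>L (harm_measure D (\<omega> D) z) (t n) \<le> (\<integral>x. real n \<partial>harm_measure D (\<omega> D) z)"
      by (rule integral_mono[OF t_int[OF z]]) (auto simp: t_def)
    also have "\<dots> \<le> real n"
      using finite_measure_harm_measure(2)[OF ph z] sets_harm_measure(1)[OF ph z]
      by (simp add: mult_left_le_one_le)
    finally have "?t n z \<le> real n" by (simp add: harm_val_interior[OF ph z])
    moreover have "0 \<le> ?t n z" by (rule harm_val_nonneg[OF ph z]) (use f0 in \<open>auto simp: t_def\<close>)
    ultimately show ?thesis by simp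
  qed
  have ht_L: "?t n \<in> harm_L D' (\<omega> D')" for n
    by (rule harm_L_bounded[OF ph' harm_val_measurable[OF t_L] h_bound[OF frontier_cases]])
  show ?thesis
    unfolding harm_L_def
  proof (intro CollectI ballI)
    fix y assume y: "y \<in> D'"
    let ?M = "harm_measure D' (\<omega> D') y"
    have yD: "y \<in> D" using y sub by auto
    have sp: "space ?M = frontier D'" by (rule sets_harm_measure(1)[OF ph' y])
    \<comment> \<open>Compatibility turns the integrals over \<open>frontier D'\<close> into values
      at \<open>y\<close> of extensions in \<open>D\<close>. These converge to the real number
      \<open>?h y\<close>, which is the finite limit that monotone convergence requires.\<close>
    have eq: "integral\<^sup>L ?M (?t n) = ?t n y" for n
      using compatible[OF t_L ht_L _ y] by (simp add: harm_val_interior[OF ph' y])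
    show "integrable ?M ?h"
    proof (rule integrable_monotone_convergence)
      show "integrable ?M (?t n)" for n using ht_L y by (auto simp: harm_L_def)
      show "AE z in ?M. mono (\<lambda>n. ?t n z)"
        by (rule AE_I2) (use h_mono frontier_cases sp in \<open>auto simp: mono_def\<close>)
      show "AE z in ?M. (\<lambda>n. ?t n z) \<longlonglongrightarrow> ?h z"
        by (rule AE_I2) (use h_lim frontier_cases sp in auto)
      show "(\<lambda>n. integral\<^sup>L ?M (?t n)) \<longlonglongrightarrow> ?h y"
        unfolding eq using h_lim yD by blast
      show "?h \<in> borel_measurable ?M" by (rule harm_val_measurable[OF f y])
    qed
  qed
qed

lemma harnack_index_mono:
  assumes A: "A \<subseteq> D'"
  shows "harnack_index A D (\<omega> D) \<le> harnack_index A D' (\<omega> D')"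
  unfolding harnack_index_def[of A D]
proof (rule Sup_least, elim CollectE exE conjE, hypsubst)
  fix x y f assume xA: "x \<in> A" and yA: "y \<in> A" and f: "f \<in> harm_L D (\<omega> D)"
    and f0: "\<forall>z\<in>frontier D. 0 \<le> f z"
  let ?h = "\<lambda>z. harm_val D (\<omega> D) z f"
  have x: "x \<in> D'" and y: "y \<in> D'" using xA yA A by auto
  have hL: "?h \<in> harm_L D' (\<omega> D')" by (rule harm_val_in_harm_L[OF f f0])
  have h0: "\<forall>z\<in>frontier D'. 0 \<le> ?h z"
  proof
    fix z assume "z \<in> frontier D'"
    then consider "z \<in> D" | "z \<in> frontier D" using frontier_cases by blast
    then show "0 \<le> ?h z"
    proof cases
      case 1
      then show ?thesis by (rule harm_val_nonneg[OF ph _ f0])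
    next
      case 2
      then show ?thesis using f0 by (simp add: harm_val_def)
    qed
  qed
  have eq: "?h z = harm_val D' (\<omega> D') z ?h" if "z \<in> D'" for z
    by (rule compatible[OF f hL refl that])
  show "ennreal (?h x) / ennreal (?h y) \<le> harnack_index A D' (\<omega> D')"
  proof (cases "harm_null D' (\<omega> D') {z \<in> frontier D'. ?h z \<noteq> 0}")
    case True
    then have "?h x = 0" using eq[OF x] harm_val_null[OF ph' x True hL] by simp
    then show ?thesis by simp
  next
    case False
    have "ennreal (harm_val D' (\<omega> D') x ?h) / ennreal (harm_val D' (\<omega> D') y ?h)
        \<le> harnack_index A D' (\<omega> D')"
      unfolding harnack_index_def by (rule Sup_upper) (use xA yA hL h0 False in blast)
    then show ?thesis using eq[OF x] eq[OF y] by simp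
  qed
qed

end

section \<open>Invariance under translation and scaling\<close>

lemma is_ts_map_inverse:
  assumes "is_ts_map \<nu>"
  obtains \<mu> where "is_ts_map \<mu>" "\<And>x. \<mu> (\<nu> x) = x" "\<And>x. \<nu> (\<mu> x) = x"
proof -
  obtain a b k where k: "k \<noteq> 0" "\<nu> = ts_map a b k" using assms by (auto simp: is_ts_map_def)
  show ?thesis
  proof
    show "is_ts_map (ts_map b a (1 / k))"
      unfolding is_ts_map_def using k(1) by (intro exI[of _ b] exI[of _ a] exI[of _ "1 / k"]) simp
  qed (use k in \<open>simp_all add: ts_map_def\<close>)
qed

text \<open>By TSCI, \<open>\<nu>\<close> pushes the harmonic measure at \<open>x\<close> forward to
  the one at \<open>\<nu> x\<close>. Change of variables then realizes each quotient for
  \<open>f\<close> on the image domain as the quotient for the composition of \<open>f\<close> with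
  \<open>\<nu>\<close> on \<open>D\<close>.\<close>

lemma harnack_index_ts_map:
  assumes sys: "radon_harmonic_measure_system \<D> \<omega>" and ts: "TSCI \<D> \<omega>"
    and D: "D \<in> \<D>" and nu: "is_ts_map \<nu>" and A: "A \<subseteq> D"
  shows "harnack_index (\<nu> ` A) (\<nu> ` D) (\<omega> (\<nu> ` D)) \<le> harnack_index A D (\<omega> D)"
proof -
  obtain \<mu> where mu: "is_ts_map \<mu>" and mn: "\<And>x. \<mu> (\<nu> x) = x" and nm: "\<And>x. \<nu> (\<mu> x) = x"
    using is_ts_map_inverse[OF nu] by blast
  define E where "E = \<nu> ` D"
  have E: "E \<in> \<D>" using ts nu D unfolding TSCI_def E_def by blast
  have muE: "\<mu> ` E = D" unfolding E_def by (simp add: image_image mn)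
  note ph = continuous_harmonicD(2)[OF sys D] and ph' = continuous_harmonicD(2)[OF sys E]
  have fwd: "\<nu> ` S \<in> harm_sets E (\<omega> E)" "\<And>x. x \<in> D \<Longrightarrow> \<omega> E (\<nu> x) (\<nu> ` S) = \<omega> D x S"
    if "S \<in> harm_sets D (\<omega> D)" for S
    using ts nu D that unfolding TSCI_def E_def by blast+
  \<comment> \<open>TSCI speaks of images only. Applied to the inverse \<open>\<mu>\<close> it
    yields preimages under \<open>\<nu>\<close>, as measurability of \<open>\<nu>\<close>
    requires.\<close>
  have bwd: "\<mu> ` S \<in> harm_sets D (\<omega> D)" if "S \<in> harm_sets E (\<omega> E)" for S
    using ts mu E that muE unfolding TSCI_def by metis
  \<comment> \<open>TSCI for the measurable set \<open>frontier D\<close> places its image in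
    \<open>harm_sets E\<close>, hence inside \<open>frontier E\<close>, without a topological
    argument about \<open>\<nu>\<close>.\<close>
  have fr1: "\<nu> z \<in> frontier E" if "z \<in> frontier D" for z
    using harm_sets_subset[OF ph' fwd(1)[OF frontier_in_harm_sets[OF ph]]] that by blast
  have vim: "\<nu> -` S \<inter> frontier D = \<mu> ` S" if "S \<in> harm_sets E (\<omega> E)" for S
  proof -
    have "\<nu> -` S = \<mu> ` S" by (auto simp: image_iff mn nm) (metis mn)
    then show ?thesis using harm_sets_subset[OF ph bwd[OF that]] by auto
  qed
  have meas: "\<nu> \<in> measurable (harm_measure D (\<omega> D) x) (harm_measure E (\<omega> E) (\<nu> x))"
    if x: "x \<in> D" for x
  proof (rule measurableI)
    have x': "\<nu> x \<in> E" using x by (simp add: E_def)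
    show "\<nu> z \<in> space (harm_measure E (\<omega> E) (\<nu> x))" if "z \<in> space (harm_measure D (\<omega> D) x)" for z
      using that fr1 sets_harm_measure(1)[OF ph x] sets_harm_measure(1)[OF ph' x'] by simp
    show "\<nu> -` S \<inter> space (harm_measure D (\<omega> D) x) \<in> sets (harm_measure D (\<omega> D) x)"
      if "S \<in> sets (harm_measure E (\<omega> E) (\<nu> x))" for S
      using that vim bwd sets_harm_measure[OF ph x] sets_harm_measure[OF ph' x'] by simp
  qed
  have dist: "distr (harm_measure D (\<omega> D) x) (harm_measure E (\<omega> E) (\<nu> x)) \<nu>
      = harm_measure E (\<omega> E) (\<nu> x)" if x: "x \<in> D" for x
  proof (rule measure_eqI)
    have x': "\<nu> x \<in> E" using x by (simp add: E_def)
    fix S assume "S \<in> sets (distr (harm_measure D (\<omega> D) x) (harm_measure E (\<omega> E) (\<nu> x)) \<nu>)"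
    then have S: "S \<in> sets (harm_measure E (\<omega> E) (\<nu> x))" by simp
    then have S': "S \<in> harm_sets E (\<omega> E)" using sets_harm_measure[OF ph' x'] by simp
    have "\<nu> ` \<mu> ` S = S" by (simp add: image_image nm)
    then have "\<omega> E (\<nu> x) S = \<omega> D x (\<mu> ` S)" using fwd(2)[OF bwd[OF S'] x] by simp
    then show "emeasure (distr (harm_measure D (\<omega> D) x) (harm_measure E (\<omega> E) (\<nu> x)) \<nu>) S
        = emeasure (harm_measure E (\<omega> E) (\<nu> x)) S"
      using emeasure_distr[OF meas[OF x] S] sets_harm_measure(1)[OF ph x] vim[OF S']
        emeasure_harm_measure[OF ph' x' S'] emeasure_harm_measure[OF ph x bwd[OF S']] by simp
  qed simp
  show ?thesis
    unfolding E_def[symmetric] harnack_index_def[of "\<nu> ` A"]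
  proof (rule Sup_least, clarify)
    fix x y f assume xA: "x \<in> A" and yA: "y \<in> A" and f: "f \<in> harm_L E (\<omega> E)"
      and f0: "\<forall>z\<in>frontier E. 0 \<le> f z"
      and nn: "\<not> harm_null E (\<omega> E) {z \<in> frontier E. f z \<noteq> 0}"
    let ?g = "\<lambda>z. f (\<nu> z)"
    have fint: "integrable (harm_measure E (\<omega> E) (\<nu> z)) f" if "z \<in> D" for z
      using f that by (auto simp: harm_L_def E_def)
    have g: "?g \<in> harm_L D (\<omega> D)"
      unfolding harm_L_def
    proof (intro CollectI ballI)
      fix z assume z: "z \<in> D"
      show "integrable (harm_measure D (\<omega> D) z) ?g"
        by (rule integrable_distr[OF meas[OF z]]) (simp add: dist[OF z] fint[OF z])
    qed
    have val: "harm_val E (\<omega> E) (\<nu> z) f = harm_val D (\<omega> D) z ?g" if z: "z \<in> D" for z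
    proof -
      have "harm_val E (\<omega> E) (\<nu> z) f = integral\<^sup>L (harm_measure E (\<omega> E) (\<nu> z)) f"
        using z by (intro harm_val_interior[OF ph']) (simp add: E_def)
      also have "\<dots> = integral\<^sup>L (harm_measure D (\<omega> D) z) ?g"
        using integral_distr[OF meas[OF z], of f] fint[OF z] dist[OF z] by simp
      finally show ?thesis by (simp add: harm_val_interior[OF ph z])
    qed
    have g0: "\<forall>z\<in>frontier D. 0 \<le> ?g z" using fr1 f0 by blast
    have "\<not> harm_null D (\<omega> D) {z \<in> frontier D. ?g z \<noteq> 0}"
    proof
      assume null: "harm_null D (\<omega> D) {z \<in> frontier D. ?g z \<noteq> 0}"
      let ?N = "{z \<in> frontier E. f z \<noteq> 0}"
      obtain u where u: "u \<in> D" using pre_harmonic_nonempty[OF ph] by auto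
      then have u': "\<nu> u \<in> E" by (simp add: E_def)
      have "f \<in> borel_measurable (harm_measure E (\<omega> E) (\<nu> u))" using fint[OF u] by simp
      then have "{z \<in> space (harm_measure E (\<omega> E) (\<nu> u)). f z \<noteq> 0} \<in> sets (harm_measure E (\<omega> E) (\<nu> u))"
        by measurable
      then have N: "?N \<in> harm_sets E (\<omega> E)" using sets_harm_measure[OF ph' u'] by simp
      have "\<mu> ` ?N = {z \<in> frontier D. ?g z \<noteq> 0}"
        using vim[OF N] fr1 by auto
      then have "\<omega> D z (\<mu> ` ?N) = 0" if "z \<in> D" for z using null that by (simp add: harm_null_def)
      moreover have "\<nu> ` \<mu> ` ?N = ?N" by (simp add: image_image nm)
      ultimately have "\<omega> E (\<nu> z) ?N = 0" if "z \<in> D" for z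
        using fwd(2)[OF bwd[OF N] that] that by simp
      then have "harm_null E (\<omega> E) ?N" by (auto simp: harm_null_def E_def)
      then show False using nn by simp
    qed
    then have "ennreal (harm_val D (\<omega> D) x ?g) / ennreal (harm_val D (\<omega> D) y ?g)
        \<le> harnack_index A D (\<omega> D)"
      unfolding harnack_index_def using xA yA g g0 by (intro Sup_upper) blast
    then show "ennreal (harm_val E (\<omega> E) (\<nu> x) f) / ennreal (harm_val E (\<omega> E) (\<nu> y) f)
        \<le> harnack_index A D (\<omega> D)"
      using val xA yA A by (simp add: subset_iff)
  qed
qed

section \<open>From the Harnack index to the inequality\<close>

text \<open>The constant \<open>C\<close> may be \<open>\<infinity>\<close>, and
  \<open>\<infinity> * 0 = 0\<close> in \<open>ennreal\<close>, so a vanishing right-hand side must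
  force the left-hand side to vanish. This follows from finiteness of the index itself, as
  \<open>a / 0 = \<infinity>\<close> for \<open>a > 0\<close>.\<close>

lemma harm_val_le_harnack_index:
  assumes ph: "pre_harmonic D w" and A: "A \<subseteq> D"
    and H: "harnack_index A D w \<le> C" "harnack_index A D w < \<infinity>"
    and f: "f \<in> harm_L D w" "\<forall>z\<in>frontier D. 0 \<le> f z" and x: "x \<in> A" and y: "y \<in> A"
  shows "ennreal (harm_val D w x f) \<le> C * ennreal (harm_val D w y f)"
proof (cases "harm_null D w {z \<in> frontier D. f z \<noteq> 0}")
  case True
  then show ?thesis using harm_val_null[OF ph _ True f(1)] x A by auto
next
  case False
  let ?a = "ennreal (harm_val D w x f)" and ?b = "ennreal (harm_val D w y f)"
  have le: "?a / ?b \<le> harnack_index A D w"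
    unfolding harnack_index_def using x y f False by (intro Sup_upper) blast
  show ?thesis
  proof (cases "?b = 0")
    case True
    have "?a = 0"
    proof (rule ccontr)
      assume "?a \<noteq> 0"
      then have "?a / ?b = \<infinity>" unfolding True by (simp add: ennreal_divide_zero)
      then show False using le H(2) by (simp add: top_unique)
    qed
    then show ?thesis by simp
  next
    case False
    have "?a = ?a / ?b * ?b" using False by (simp add: ennreal_divide_times ennreal_mult_divide_eq)
    also have "\<dots> \<le> C * ?b" using le H(1) by (intro mult_right_mono) auto
    finally show ?thesis .
  qed
qed

text \<open>The inequality of indices passes through the intermediate domain
  \<open>\<nu>(D\<^sub>1)\<close>. The two finiteness claims are separate kernel bounds: one for the
  kernel of \<open>D\<close> near \<open>\<nu>(A)\<close>, using compactness of
  \<open>frontier D\<close>, and one for the kernel of \<open>D\<^sub>1\<close> near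
  \<open>A\<close>, using compactness of \<open>frontier D\<^sub>1\<close>.\<close>

theorem theorem2p19:
  fixes \<D> :: "(real ^ 'n) set set"
    and \<omega> :: "(real ^ 'n) set \<Rightarrow> real ^ 'n \<Rightarrow> (real ^ 'n) set \<Rightarrow> ennreal"
    and D D\<^sub>1 A :: "(real ^ 'n) set"
    and \<nu> :: "real ^ 'n \<Rightarrow> real ^ 'n"
  assumes "radon_harmonic_measure_system \<D> \<omega>"
    and "TSCI \<D> \<omega>"
    and "\<forall>E\<in>\<D>. continuous_RN E (\<omega> E)"
    and "D \<in> \<D>" and "D\<^sub>1 \<in> \<D>"
    and "compact (closure A)" and "closure A \<subseteq> D\<^sub>1" and "D\<^sub>1 \<subseteq> D"
    and "compact (frontier D)"
    and "is_ts_map \<nu>" and "\<nu> ` D\<^sub>1 \<subseteq> D"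
  shows "harnack_index (\<nu> ` A) D (\<omega> D) \<le> harnack_index A D\<^sub>1 (\<omega> D\<^sub>1) \<and>
         harnack_index (\<nu> ` A) D (\<omega> D) < \<infinity> \<and>
         (compact (frontier D\<^sub>1) \<longrightarrow> harnack_index A D\<^sub>1 (\<omega> D\<^sub>1) < \<infinity>) \<and>
         (\<forall>f\<in>harm_L D (\<omega> D). (\<forall>z\<in>frontier D. 0 \<le> f z) \<longrightarrow>
            (\<forall>x\<in>\<nu> ` A. \<forall>y\<in>\<nu> ` A.
               ennreal (harm_val D (\<omega> D) x f) \<le>
                 harnack_index A D\<^sub>1 (\<omega> D\<^sub>1) * ennreal (harm_val D (\<omega> D) y f)))"
proof -
  note sys = assms(1) and ts = assms(2) and D = assms(4) and D1 = assms(5) and nu = assms(10)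
  have AD1: "A \<subseteq> D\<^sub>1" using assms(7) closure_subset by blast
  have D': "\<nu> ` D\<^sub>1 \<in> \<D>" using ts nu D1 unfolding TSCI_def by blast
  interpret nested_domains \<D> \<omega> D "\<nu> ` D\<^sub>1"
    by unfold_locales (use assms D' in auto)
  have "harnack_index (\<nu> ` A) D (\<omega> D) \<le> harnack_index (\<nu> ` A) (\<nu> ` D\<^sub>1) (\<omega> (\<nu> ` D\<^sub>1))"
    by (rule harnack_index_mono) (use AD1 in blast)
  also have "\<dots> \<le> harnack_index A D\<^sub>1 (\<omega> D\<^sub>1)"
    by (rule harnack_index_ts_map[OF sys ts D1 nu AD1])
  finally have le: "harnack_index (\<nu> ` A) D (\<omega> D) \<le> harnack_index A D\<^sub>1 (\<omega> D\<^sub>1)" .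
  obtain a b k where "\<nu> = ts_map a b k" using nu by (auto simp: is_ts_map_def)
  then have "continuous_on (closure A) \<nu>" by (auto simp: ts_map_def intro!: continuous_intros)
  then have c: "compact (\<nu> ` closure A)" using assms(6) by (rule compact_continuous_image)
  \<comment> \<open>The compact image of \<open>closure A\<close> is closed, so it contains the
    closure of \<open>\<nu>(A)\<close>; it also lies in \<open>\<nu>(D\<^sub>1)\<close>, hence in
    \<open>D\<close>.\<close>
  then have cl: "closure (\<nu> ` A) \<subseteq> \<nu> ` closure A"
    by (intro closure_minimal compact_imp_closed image_mono closure_subset)
  then have "compact (closure (\<nu> ` A))"
    using c by (meson closed_closure bounded_subset compact_eq_bounded_closed)
  moreover have clD: "closure (\<nu> ` A) \<subseteq> D" using cl assms(7,11) by blast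
  ultimately have fin: "harnack_index (\<nu> ` A) D (\<omega> D) < \<infinity>"
    using assms(9) by (intro harnack_index_finite[OF ph rn])
  have "harnack_index A D\<^sub>1 (\<omega> D\<^sub>1) < \<infinity>" if "compact (frontier D\<^sub>1)"
    using assms(3,6,7) D1 that by (intro harnack_index_finite[OF continuous_harmonicD(2)[OF sys D1]]) auto
  moreover have "\<nu> ` A \<subseteq> D" using clD closure_subset by blast
  ultimately show ?thesis
    using le fin harm_val_le_harnack_index[OF ph _ le fin] by auto
qed

end
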